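(* Let $m_1,\dots,m_n$ be soft modules with areas $s_1\ge s_2\ge\dots\ge s_n>0$, and let the circuit be a rectangle of width $W>0$ and height $H>0$ with $WH=\sum_{k=1}^n s_k$. Suppose that: (1) all the modules have a uniform bounding factor $\lambda\ge 3$, i.e. the allowed aspect ratio (height/width) interval of every module is $[1/\lambda,\lambda]$; (2) the aspect ratio $\gamma_A=H/W$ of the circuit lies in $[1/\lambda,\lambda]$; (3) $$\max_{1\le i\le n-1}\ \frac{s_i}{\sum_{j=i+1}^n s_j}\le\lambda-1 .$$ Then the Iterative Merging Placement (IMP) algorithm places all the modules feasibly, i.e. the dimensions and positions it assigns to $m_1,\dots,m_n$ form a feasible layout on the circuit.
   Context: **Problem.** A soft module $m_i$ has a fixed area $s_i$ and an allowed aspect ratio interval $[1/\lambda_i,\lambda_i]$, $\lambda_i\ge1$; $\lambda_i$ is its bounding factor. The aspect ratio of a rectangle is height divided by width. A layout assigns to each $m_i$ an axis-parallel rectangle of width $w_i$ and height $h_i$ with $w_ih_i=s_i$, with bottom-left vertex $(x_{i1},y_{i1})$ and upper-right vertex $(x_{i2},y_{i2})$. It is feasible on the circuit $[0,W]\times[0,H]$ if for all $i\neq j$: - $x_{i2}-x_{i1}=w_i$ and $y_{i2}-y_{i1}=h_i$; - $1/\lambda_i\le h_i/w_i\le\lambda_i$; - $\max(x_{i1}-x_{j2},\,y_{i1}-y_{j2},\,x_{j1}-x_{i2},\,y_{j1}-y_{i2})\ge0$ (no overlap); - $0\le x_{ik}\le W$ and $0\le y_{ik}\le H$ for $k\in\{1,2\}$.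 **Composite modules.** A single soft module is a composite module. Two composite modules (the sub-modules) may be merged, horizontally (side by side) or vertically (one on top of the other), along sides of equal length to form a bigger composite module, whose area is the sum of their areas. **The IMP algorithm.** Input: the sequence $m_1,\dots,m_n$, sorted by non-increasing area, and the $W\times H$ circuit with $WH=\sum_k s_k$. *Stage I.* While the current sequence contains more than one module: remove the two last modules $m_i,m_j$ of the sequence (two modules of least area) and merge them into a composite module $m_c$, recording only which two sub-modules it has (not yet the direction or order of merging); insert $m_c$ into the sequence at the position $k$ such that the areas satisfy $s_{k-1}>s_k\ge s_{k+1}$, where $s_k$ is the area of $m_c$ (so the sequence stays non-increasing, and $m_c$ is put in front of modules of equal area); push $m_c$ onto a stack. *Stage II.* Place the single remaining module so that it coincides with the circuit rectangle. While the stack is nonempty: pop a composite module $m_c$, with sub-modules $m_i,m_j$, whose rectangle has already been determined and has aspect ratio $\gamma_c$. If $\gamma_c\ge1$, $m_i$ and $m_j$ are merged vertically with the larger one on top; otherwise they are merged horizontally with the larger one on the left. That is, the rectangle of $m_c$ is cut by one horizontal (respectively vertical) segment into two rectangles having the areas of $m_i$ and $m_j$, which become the rectangles of $m_i$ and $m_j$. The output is the collection of rectangles assigned to the original modules $m_1,\dots,m_n$. *)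

theory Defs
  imports Complex_Main
begin

datatype rect = Rect (x1: real) (y1: real) (x2: real) (y2: real)

definition width :: "rect \<Rightarrow> real" where
  "width r = x2 r - x1 r"

definition height :: "rect \<Rightarrow> real" where
  "height r = y2 r - y1 r"

definition aspect_ratio :: "rect \<Rightarrow> real" where
  "aspect_ratio r = height r / width r"

text \<open>
  The modules are \<open>1, \<dots>, n\<close>, with areas \<open>s\<close> and bounding factors \<open>lam\<close>. Module \<open>i\<close> has
  dimensions \<open>w i\<close>, \<open>h i\<close>, bottom-left vertex \<open>(xl i, yl i)\<close> and upper-right vertex
  \<open>(xu i, yu i)\<close>.
\<close>

definition feasible_layout ::
  "nat \<Rightarrow> (nat \<Rightarrow> real) \<Rightarrow> (nat \<Rightarrow> real) \<Rightarrow> real \<Rightarrow> real \<Rightarrow>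
   (nat \<Rightarrow> real) \<Rightarrow> (nat \<Rightarrow> real) \<Rightarrow> (nat \<Rightarrow> real) \<Rightarrow> (nat \<Rightarrow> real) \<Rightarrow>
   (nat \<Rightarrow> real) \<Rightarrow> (nat \<Rightarrow> real) \<Rightarrow> bool" where
  "feasible_layout n s lam W H w h xl yl xu yu \<longleftrightarrow>
     (\<forall>i\<in>{1..n}.
        w i > 0 \<and> h i > 0 \<and> w i * h i = s i \<and>
        xu i - xl i = w i \<and> yu i - yl i = h i \<and>
        1 / lam i \<le> h i / w i \<and> h i / w i \<le> lam i \<and>
        0 \<le> xl i \<and> xl i \<le> W \<and> 0 \<le> xu i \<and> xu i \<le> W \<and>
        0 \<le> yl i \<and> yl i \<le> H \<and> 0 \<le> yu i \<and> yu i \<le> H) \<and>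
     (\<forall>i\<in>{1..n}. \<forall>j\<in>{1..n}. i \<noteq> j \<longrightarrow>
        Max {xl i - xu j, yl i - yu j, xl j - xu i, yl j - yu i} \<ge> 0)"

text \<open>
  A composite module records only its sub-modules; direction and order of the merging are
  decided in Stage II. Every original module occurs in at most one place, so composite modules
  of one run that are equal as trees are the same module.
\<close>

datatype cmod = Soft nat | Merge cmod cmod

primrec area :: "(nat \<Rightarrow> real) \<Rightarrow> cmod \<Rightarrow> real" where
  "area s (Soft i) = s i"
| "area s (Merge a b) = area s a + area s b"

text \<open>
  On a sequence with non-increasing areas, \<open>c\<close> is put behind all modules of strictly larger
  area and in front of those of equal area.
\<close>

definition insert_cmod :: "(nat \<Rightarrow> real) \<Rightarrow> cmod \<Rightarrow> cmod list \<Rightarrow> cmod list" where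
  "insert_cmod s c ms =
     takeWhile (\<lambda>m. area s m > area s c) ms @ c # dropWhile (\<lambda>m. area s m > area s c) ms"

lemma length_insert_cmod [simp]: "length (insert_cmod s c ms) = Suc (length ms)"
proof -
  let ?P = "\<lambda>m. area s m > area s c"
  have "length (takeWhile ?P ms) + length (dropWhile ?P ms) = length ms"
    by (metis length_append takeWhile_dropWhile_id)
  then show ?thesis by (simp add: insert_cmod_def)
qed

text \<open>Stage I: the arguments are the current sequence and the stack, with its top first.\<close>

function imp_stage1 ::
  "(nat \<Rightarrow> real) \<Rightarrow> cmod list \<Rightarrow> cmod list \<Rightarrow> cmod list \<times> cmod list" where
  "imp_stage1 s ms st =
     (if length ms > 1 then
        let c = Merge (last (butlast ms)) (last ms)
        in imp_stage1 s (insert_cmod s c (butlast (butlast ms))) (c # st)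
      else (ms, st))"
  by pat_completeness auto
termination
  by (relation "measure (\<lambda>(s, ms, st). length ms)") auto

declare imp_stage1.simps [simp del]

text \<open>
  \<open>tie\<close> decides which of two sub-modules of equal area is treated as the larger one.
\<close>

definition by_size ::
  "(nat \<Rightarrow> real) \<Rightarrow> (cmod \<Rightarrow> cmod \<Rightarrow> bool) \<Rightarrow> cmod \<Rightarrow> cmod \<Rightarrow> cmod \<times> cmod" where
  "by_size s tie a b =
     (if area s a > area s b \<or> (area s a = area s b \<and> tie a b) then (a, b) else (b, a))"

text \<open>
  \<open>split_rect r A B\<close> cuts \<open>r\<close>, which has area \<open>A + B\<close>, into the rectangles of the larger
  sub-module (of area \<open>A\<close>, on top or on the left) and of the smaller one (of area \<open>B\<close>).
\<close>

definition split_rect :: "rect \<Rightarrow> real \<Rightarrow> real \<Rightarrow> rect \<times> rect" where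
  "split_rect r A B =
     (if aspect_ratio r \<ge> 1 then
        let y = y1 r + B / width r
        in (Rect (x1 r) y (x2 r) (y2 r), Rect (x1 r) (y1 r) (x2 r) y)
      else
        let x = x1 r + A / height r
        in (Rect (x1 r) (y1 r) x (y2 r), Rect x (y1 r) (x2 r) (y2 r)))"

text \<open>
  Stage II: the map holds the rectangles determined so far. Stage I pushes only composite
  modules, so the third equation is never used by the algorithm.
\<close>

fun imp_stage2 ::
  "(nat \<Rightarrow> real) \<Rightarrow> (cmod \<Rightarrow> cmod \<Rightarrow> bool) \<Rightarrow> (cmod \<rightharpoonup> rect) \<Rightarrow> cmod list \<Rightarrow>
   (cmod \<rightharpoonup> rect)" where
  "imp_stage2 s tie R [] = R"
| "imp_stage2 s tie R (Merge a b # st) =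
     (let (big, small) = by_size s tie a b;
          (rbig, rsmall) = split_rect (the (R (Merge a b))) (area s big) (area s small)
      in imp_stage2 s tie (R(big \<mapsto> rbig, small \<mapsto> rsmall)) st)"
| "imp_stage2 s tie R (Soft i # st) = imp_stage2 s tie R st"

definition imp ::
  "nat \<Rightarrow> (nat \<Rightarrow> real) \<Rightarrow> real \<Rightarrow> real \<Rightarrow> (cmod \<Rightarrow> cmod \<Rightarrow> bool) \<Rightarrow> (nat \<rightharpoonup> rect)" where
  "imp n s W H tie =
     (let (ms, st) = imp_stage1 s (map Soft [1..<n + 1]) [];
          R = imp_stage2 s tie [hd ms \<mapsto> Rect 0 0 W H] st
      in (\<lambda>i. R (Soft i)))"

end

(* Cutting a rectangle of aspect ratio in [1/lambda, lambda] across its longer side keeps both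
   parts in that range as soon as the larger part has at most lambda - 1 times the area of the
   smaller one. So it suffices to bound the ratio of the areas at each merge of Stage I.
   A composite module has at most twice the area of any other module present in the sequence,
   since it was made from two modules of least area. Let x and y be the two modules merged, y the
   smaller one. If some module other than y is composite, then x <= 2 y. Otherwise let i be the
   largest index of a simple module other than y: then y contains all modules after i and has
   area at least s_{i+1} + ... + s_n, so hypothesis (3) bounds x <= s_i; for i = n already
   x <= s_n <= y. *)

theory Submission
  imports Defs "HOL-Library.Multiset"
begin

subsection \<open>Cutting rectangles\<close>

definition fits :: "real \<Rightarrow> real \<Rightarrow> rect \<Rightarrow> bool" where
  "fits l A r \<longleftrightarrow> width r > 0 \<and> height r > 0 \<and> width r * height r = A \<and>
     1 / l \<le> aspect_ratio r \<and> aspect_ratio r \<le> l"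

definition inside :: "rect \<Rightarrow> rect \<Rightarrow> bool" where
  "inside r q \<longleftrightarrow> x1 q \<le> x1 r \<and> x2 r \<le> x2 q \<and> y1 q \<le> y1 r \<and> y2 r \<le> y2 q"

text \<open>The four disjuncts are the four differences in the no-overlap condition being
  nonnegative. The inequalities are weak, so rectangles may share boundary points.\<close>

definition separated :: "rect \<Rightarrow> rect \<Rightarrow> bool" where
  "separated r q \<longleftrightarrow> x2 q \<le> x1 r \<or> y2 q \<le> y1 r \<or> x2 r \<le> x1 q \<or> y2 r \<le> y1 q"

lemma inside_trans: "inside r q \<Longrightarrow> inside q p \<Longrightarrow> inside r p"
  by (auto simp: inside_def)

lemma separated_sym: "separated r q \<Longrightarrow> separated q r"
  by (auto simp: separated_def)

lemma separated_inside: "separated q p \<Longrightarrow> inside r q \<Longrightarrow> separated r p"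
  by (auto simp: separated_def inside_def)

text \<open>Both parts keep the shorter side of \<open>r\<close>, of length d say, so a part of area
  C has aspect ratio C / d^2 or d^2 / C. One bound follows from d^2 \<le> A + B \<le> l * C, the
  other from C \<le> A + B and the bound on the aspect ratio of \<open>r\<close>.\<close>

lemma fits_split_rect:
  assumes fit: "fits l (A + B) r" and "B > 0" "B \<le> A" and ratio: "A \<le> (l - 1) * B"
    and split: "split_rect r A B = (q, p)"
  shows "fits l A q \<and> fits l B p \<and> inside q r \<and> inside p r \<and> separated q p"
proof -
  define w h where "w = width r" and "h = height r"
  have w: "w > 0" and h: "h > 0" and wh: "w * h = A + B"
    and lo: "1 / l \<le> h / w" and hi: "h / w \<le> l"
    using fit by (auto simp: fits_def w_def h_def aspect_ratio_def)
  have "A > 0" using assms by simp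
  have l: "l > 0" using hi w h by (smt (verit) divide_pos_pos)
  \<comment> \<open>The ratio hypothesis says that the whole is at most \<open>l\<close> times the
    smaller part, hence also at most \<open>l\<close> times the larger one.\<close>
  have lB: "A + B \<le> l * B" using ratio by (simp add: algebra_simps)
  have lA: "A + B \<le> l * A" using lB \<open>B \<le> A\<close> l by (smt (verit) mult_left_mono)
  have x2: "x2 r = x1 r + w" and y2: "y2 r = y1 r + h"
    by (simp_all add: w_def h_def width_def height_def)
  show ?thesis
  proof (cases "w \<le> h")
    case True
    then have asp: "aspect_ratio r \<ge> 1" using w by (simp add: aspect_ratio_def w_def h_def)
    have q: "q = Rect (x1 r) (y1 r + B / w) (x2 r) (y2 r)"
      and p: "p = Rect (x1 r) (y1 r) (x2 r) (y1 r + B / w)"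
      using split asp by (auto simp: split_rect_def w_def Let_def)
    have hB: "h - B / w = A / w" using wh w by (simp add: field_simps)
    have ww: "w * w \<le> A + B" using True w wh by (metis mult_left_mono less_imp_le)
    have hw: "h / w = (A + B) / (w * w)" using wh w by (simp add: field_simps)
    have le: "C / (w * w) \<le> l" if "C \<le> A + B" for C
      using that hi w unfolding hw by (smt (verit) divide_right_mono mult_pos_pos)
    have ge: "1 / l \<le> C / (w * w)" if "A + B \<le> l * C" for C
      using that ww w l by (simp add: field_simps)
    have "B / w \<le> h" using hB \<open>A > 0\<close> w by (smt (verit) divide_pos_pos)
    then show ?thesis
      using le[of A] le[of B] ge[OF lA] ge[OF lB] w \<open>A > 0\<close> \<open>B > 0\<close>
      by (simp add: q p fits_def inside_def separated_def width_def height_def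
          aspect_ratio_def x2 y2 hB add_diff_eq[symmetric] diff_diff_add[symmetric])
  next
    case False
    then have asp: "\<not> aspect_ratio r \<ge> 1" using w by (simp add: aspect_ratio_def w_def h_def)
    have q: "q = Rect (x1 r) (y1 r) (x1 r + A / h) (y2 r)"
      and p: "p = Rect (x1 r + A / h) (y1 r) (x2 r) (y2 r)"
      using split asp by (auto simp: split_rect_def h_def Let_def)
    have wA: "w - A / h = B / h" using wh h by (simp add: field_simps)
    have hh: "h * h \<le> A + B" using False h wh by (smt (verit) mult_right_mono)
    have hw: "h / w = (h * h) / (A + B)" using wh h w by (simp add: field_simps flip: wh)
    have ge: "1 / l \<le> (h * h) / C" if "C \<le> A + B" "C > 0" for C
      using that lo h unfolding hw by (smt (verit) divide_left_mono mult_pos_pos)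
    have le: "(h * h) / C \<le> l" if "A + B \<le> l * C" "C > 0" for C
      using that hh by (simp add: field_simps)
    have "A / h \<le> w" using wA \<open>B > 0\<close> h by (smt (verit) divide_pos_pos)
    then show ?thesis
      using ge[of A] ge[of B] le[OF lA] le[OF lB] h \<open>A > 0\<close> \<open>B > 0\<close>
      by (simp add: q p fits_def inside_def separated_def width_def height_def
          aspect_ratio_def x2 y2 wA add_diff_eq[symmetric] diff_diff_add[symmetric])
  qed
qed

text \<open>A merge pushed early in Stage I is popped late in Stage II, so an induction along Stage
  I must detach the end of the stack.\<close>

lemma imp_stage2_append:
  "imp_stage2 s tie R (st @ st') = imp_stage2 s tie (imp_stage2 s tie R st) st'"
proof (induction st arbitrary: R)
  case (Cons c st)
  then show ?case by (cases c) (simp_all add: Let_def case_prod_unfold del: fun_upd_apply)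
qed simp

subsection \<open>Modules of a composite module\<close>

text \<open>A list and not a set, so that distinctness can express that no original module is used
  twice.\<close>

primrec leaves :: "cmod \<Rightarrow> nat list" where
  "leaves (Soft i) = [i]"
| "leaves (Merge a b) = leaves a @ leaves b"

lemma leaves_ne [simp]: "leaves m \<noteq> []"
  by (induction m) auto

lemma area_leaves: "area s m = sum_list (map s (leaves m))"
  by (induction m) auto

text \<open>Two equal entries would repeat a leaf, because no module has an empty list of
  leaves.\<close>

lemma distinct_leavesD:
  "distinct (concat (map leaves ms)) \<Longrightarrow> distinct ms"
proof -
  assume "distinct (concat (map leaves ms))"
  moreover have "removeAll [] (map leaves ms) = map leaves ms"
    by (rule removeAll_id) (auto dest: sym)
  ultimately show ?thesis by (simp add: distinct_concat_iff distinct_map)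
qed

section \<open>Insertion into the sequence\<close>

lemma mset_insert_cmod: "mset (insert_cmod s c ms) = add_mset c (mset ms)"
proof -
  let ?P = "\<lambda>m. area s m > area s c"
  have "mset ms = mset (takeWhile ?P ms) + mset (dropWhile ?P ms)"
    by (metis mset_append takeWhile_dropWhile_id)
  then show ?thesis by (simp add: insert_cmod_def)
qed

lemma set_insert_cmod [simp]: "set (insert_cmod s c ms) = insert c (set ms)"
  by (metis mset_insert_cmod set_mset_add_mset_insert set_mset_mset)

lemma mset_concat_map_cong:
  "mset xs = mset ys \<Longrightarrow> mset (concat (map f xs)) = mset (concat (map f ys))"
  by (metis mset_concat mset_map map_map sum_mset_sum_list)

lemma mset_leaves_insert_cmod:
  "mset (concat (map leaves (insert_cmod s c ms))) =
   mset (leaves c) + mset (concat (map leaves ms))"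
  using mset_concat_map_cong[of "insert_cmod s c ms" "c # ms" leaves]
  by (simp add: mset_insert_cmod)

definition nonincreasing :: "(nat \<Rightarrow> real) \<Rightarrow> cmod list \<Rightarrow> bool" where
  "nonincreasing s = sorted_wrt (\<lambda>a b. area s b \<le> area s a)"

lemma nonincreasing_insert_cmod:
  assumes "nonincreasing s ms"
  shows "nonincreasing s (insert_cmod s c ms)"
  using assms
proof (induction ms)
  case (Cons m ms)
  show ?case
  proof (cases "area s m > area s c")
    case True
    then have "insert_cmod s c (m # ms) = m # insert_cmod s c ms" by (simp add: insert_cmod_def)
    then show ?thesis using Cons True by (auto simp: nonincreasing_def)
  next
    case False
    then have "insert_cmod s c (m # ms) = c # m # ms" by (simp add: insert_cmod_def)
    then show ?thesis using Cons.prems False by (fastforce simp: nonincreasing_def)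
  qed
qed (simp add: nonincreasing_def insert_cmod_def)

subsection \<open>The merging stage\<close>

text \<open>\<open>tail\<close> is hypothesis (3) with the positive denominators cleared.\<close>

locale soft_modules =
  fixes n :: nat and s :: "nat \<Rightarrow> real" and l :: real
  assumes n: "n \<ge> 1"
    and mono: "\<And>i j. 1 \<le> i \<Longrightarrow> i \<le> j \<Longrightarrow> j \<le> n \<Longrightarrow> s j \<le> s i"
    and s_n: "s n > 0"
    and l: "l \<ge> 3"
    and tail: "\<And>i. 1 \<le> i \<Longrightarrow> i < n \<Longrightarrow> s i \<le> (l - 1) * (\<Sum>j=i + 1..n. s j)"
begin

lemma s_pos: "i \<in> {1..n} \<Longrightarrow> s i > 0"
  using mono[of i n] s_n by fastforce

lemma sum_area_mono:
  assumes "I \<subseteq> J" "J \<subseteq> {1..n}"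
  shows "sum s I \<le> sum s J"
proof (rule sum_mono2)
  show "finite J" using assms(2) finite_subset by blast
  show "0 \<le> s i" if "i \<in> J - I" for i
    using s_pos[of i] that assms(2) by (auto simp del: atLeastAtMost_iff)
qed (fact assms(1))

text \<open>Merging two entries of least area is the rule of Huffman coding. The multiset equation
  makes every original module occur exactly once. In the last clause \<open>m\<close> may be the
  composite itself, which is harmless as areas are positive.\<close>

definition huffman_inv :: "cmod list \<Rightarrow> bool" where
  "huffman_inv ms \<longleftrightarrow> nonincreasing s ms \<and> mset (concat (map leaves ms)) = mset [1..<n + 1] \<and>
     (\<forall>u v m. Merge u v \<in> set ms \<longrightarrow> m \<in> set ms \<longrightarrow> area s (Merge u v) \<le> 2 * area s m)"

lemma inv_leaves:
  assumes "huffman_inv ms"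
  shows "distinct (concat (map leaves ms))" "set (concat (map leaves ms)) = {1..n}"
proof -
  have eq: "mset (concat (map leaves ms)) = mset [1..<n + 1]"
    using assms by (simp add: huffman_inv_def)
  show "distinct (concat (map leaves ms))"
    using mset_eq_imp_distinct_iff[OF eq] by simp
  show "set (concat (map leaves ms)) = {1..n}"
    using mset_eq_setD[OF eq] by auto
qed

lemma inv_area:
  assumes "huffman_inv ms" "m \<in> set ms"
  shows "area s m = sum s (set (leaves m))" "set (leaves m) \<subseteq> {1..n}" "area s m > 0"
proof -
  have "distinct (leaves m)"
    using inv_leaves(1)[OF assms(1)] assms(2) by (auto simp: distinct_concat_iff)
  then show eq: "area s m = sum s (set (leaves m))"
    by (simp add: area_leaves sum_list_distinct_conv_sum_set)
  show sub: "set (leaves m) \<subseteq> {1..n}" using inv_leaves(2)[OF assms(1)] assms(2) by auto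
  show "area s m > 0"
    unfolding eq by (rule sum_pos) (use s_pos sub in auto)
qed

lemma merge_ratio:
  assumes inv: "huffman_inv (rest @ [x, y])"
  shows "area s x \<le> (l - 1) * area s y"
proof (cases "\<exists>u v. Merge u v \<in> set (rest @ [x])")
  case True
  then obtain u v where uv: "Merge u v \<in> set (rest @ [x])" by blast
  \<comment> \<open>\<open>x\<close> ends the non-increasing list \<open>rest @ [x]\<close>, so it
    has the least area there.\<close>
  have "area s x \<le> area s (Merge u v)"
    using inv uv by (auto simp: huffman_inv_def nonincreasing_def sorted_wrt_append)
  also have "\<dots> \<le> 2 * area s y"
    using inv uv unfolding huffman_inv_def
    by (metis Un_iff append.assoc append_Cons append_Nil list.set_intros(1) set_append)
  \<comment> \<open>The threshold 3 for the bounding factor comes from here: 2 \<le> l - 1.\<close>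
  also have "\<dots> \<le> (l - 1) * area s y"
    using l inv_area(3)[OF inv, of y] by (intro mult_right_mono) auto
  finally show ?thesis .
next
  case False
  \<comment> \<open>The indices of the simple modules other than \<open>y\<close>. In this case
    \<open>x\<close> is itself simple, so \<open>K\<close> is nonempty and has a maximum
    \<open>t\<close>.\<close>
  define K where "K = {k. Soft k \<in> set (rest @ [x])}"
  have sub: "K \<subseteq> {1..n}" using inv_area(2)[OF inv, of "Soft _"] unfolding K_def
    by (auto simp del: atLeastAtMost_iff)
  obtain i where xi: "x = Soft i" using False by (cases x) auto
  then have iK: "i \<in> K" by (simp add: K_def)
  define t where "t = Max K"
  have fin: "finite K" using sub finite_subset by blast
  then have tK: "t \<in> K" using iK unfolding t_def by (intro Max_in) auto
  have it: "i \<le> t" using fin iK by (simp add: t_def)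
  have xt: "area s x \<le> s t"
    using inv tK by (auto simp: K_def huffman_inv_def nonincreasing_def sorted_wrt_append)
  have y: "area s y = sum s (set (leaves y))" "set (leaves y) \<subseteq> {1..n}" "area s y > 0"
    using inv_area[OF inv, of y] by auto
  show ?thesis
  \<comment> \<open>For \<open>t = n\<close> there is no tail to compare with; instead
    \<open>y\<close> contains some module, whose area is at least that of the smallest module
    \<open>n\<close>.\<close>
  proof (cases "t = n")
    case True
    have "hd (leaves y) \<in> set (leaves y)" by simp
    then have "s (hd (leaves y)) \<le> sum s (set (leaves y))"
      using sum_area_mono[of "{hd (leaves y)}" "set (leaves y)"] y(2) by simp
    moreover have "s n \<le> s (hd (leaves y))"
      using y(2) \<open>hd (leaves y) \<in> set (leaves y)\<close> mono
      by (metis atLeastAtMost_iff order_refl subsetD)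
    ultimately have "area s x \<le> 1 * area s y" using xt True y(1) by simp
    also have "\<dots> \<le> (l - 1) * area s y" using l y(3) by (intro mult_right_mono) auto
    finally show ?thesis .
  next
    case False
    then have t: "1 \<le> t" "t < n" using tK sub by fastforce+
    \<comment> \<open>Outside \<open>y\<close> all modules are simple, with indices at most
      \<open>t\<close>, so any later index can only occur in \<open>y\<close>.\<close>
    have "{t + 1..n} \<subseteq> set (leaves y)"
    proof
      fix j assume j: "j \<in> {t + 1..n}"
      then have "j \<in> set (concat (map leaves (rest @ [x, y])))"
        unfolding inv_leaves(2)[OF inv] by simp
      then obtain m where m: "m \<in> set (rest @ [x, y])" "j \<in> set (leaves m)" by auto
      have "m = y"
      proof (rule ccontr)
        assume "m \<noteq> y"
        then have mr: "m \<in> set (rest @ [x])" using m(1) by auto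
        then obtain k where "m = Soft k"
          using \<open>\<nexists>u v. Merge u v \<in> set (rest @ [x])\<close> by (metis cmod.exhaust)
        then have "j \<in> K" using mr m(2) by (auto simp: K_def)
        then have "j \<le> t" using fin by (simp add: t_def)
        then show False using j by simp
      qed
      then show "j \<in> set (leaves y)" using m by simp
    qed
    then have "(\<Sum>j=t + 1..n. s j) \<le> area s y"
      unfolding y(1) using y(2) by (rule sum_area_mono)
    then have "(l - 1) * (\<Sum>j=t + 1..n. s j) \<le> (l - 1) * area s y"
      using l by (intro mult_left_mono) auto
    with xt tail[OF t] show ?thesis by linarith
  qed
qed

text \<open>Since \<open>x\<close> and \<open>y\<close> are least, their sum is at most twice the
  area of any remaining module. An old composite is at most twice \<open>x\<close>, hence at most
  twice the new module.\<close>

lemma inv_step: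
  assumes inv: "huffman_inv (rest @ [x, y])"
  shows "huffman_inv (insert_cmod s (Merge x y) rest)"
  unfolding huffman_inv_def
proof (intro conjI allI impI)
  have srt: "nonincreasing s rest" and yx: "area s y \<le> area s x"
    and least: "\<And>m. m \<in> set rest \<Longrightarrow> area s x \<le> area s m"
    and two: "\<And>u v m. Merge u v \<in> set (rest @ [x, y]) \<Longrightarrow> m \<in> set (rest @ [x, y]) \<Longrightarrow>
      area s (Merge u v) \<le> 2 * area s m"
    and ms: "mset (concat (map leaves (rest @ [x, y]))) = mset [1..<n + 1]"
    using inv unfolding huffman_inv_def nonincreasing_def sorted_wrt_append by auto
  have pos: "area s x > 0" "area s y > 0" using inv_area(3)[OF inv] by auto
  show "nonincreasing s (insert_cmod s (Merge x y) rest)"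
    using srt by (rule nonincreasing_insert_cmod)
  show "mset (concat (map leaves (insert_cmod s (Merge x y) rest))) = mset [1..<n + 1]"
    using ms unfolding mset_leaves_insert_cmod by (simp add: ac_simps del: upt_Suc)
  fix u v m
  assume uv: "Merge u v \<in> set (insert_cmod s (Merge x y) rest)"
    and m: "m \<in> set (insert_cmod s (Merge x y) rest)"
  show "area s (Merge u v) \<le> 2 * area s m"
  proof (cases "Merge u v \<in> set rest")
    case True
    show ?thesis
    proof (cases "m \<in> set rest")
      case False
      then have "m = Merge x y" using m by simp
      then show ?thesis using two[of u v x] True pos by simp
    qed (use two[of u v m] True in simp)
  next
    case False
    then have "u = x" "v = y" using uv by auto
    then show ?thesis using m least[of m] yx pos by auto
  qed
qed

lemma inv_init: "huffman_inv (map Soft [1..<n + 1])"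
proof -
  have "nonincreasing s (map Soft [1..<n + 1])"
    unfolding nonincreasing_def sorted_wrt_map
    by (rule sorted_wrt_mono_rel[OF _ sorted_wrt_upt]) (use mono in auto)
  moreover have "concat (map leaves (map Soft [1..<n + 1])) = [1..<n + 1]"
    by (simp add: comp_def del: upt_Suc)
  ultimately show ?thesis unfolding huffman_inv_def by (auto simp del: upt_Suc)
qed

subsection \<open>The placing stage\<close>

text \<open>\<open>R\<close> may still hold rectangles of composites that were already cut; only the
  entries of the current sequence \<open>ms\<close> are constrained.\<close>

definition placed :: "rect \<Rightarrow> (cmod \<rightharpoonup> rect) \<Rightarrow> cmod list \<Rightarrow> bool" where
  "placed C R ms \<longleftrightarrow>
     (\<forall>m\<in>set ms. \<exists>r. R m = Some r \<and> fits l (area s m) r \<and> inside r C) \<and>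
     (\<forall>m\<in>set ms. \<forall>m'\<in>set ms. m \<noteq> m' \<longrightarrow> separated (the (R m)) (the (R m')))"

text \<open>One pop in Stage II undoes one merge of Stage I: it leads from a placement of the
  sequence after the merge to one of the sequence before it.\<close>

lemma placed_step:
  assumes inv: "huffman_inv (rest @ [x, y])"
    and placed: "placed C R (insert_cmod s (Merge x y) rest)"
  shows "placed C (imp_stage2 s tie R [Merge x y]) (rest @ [x, y])"
proof -
  obtain r where r: "R (Merge x y) = Some r" "fits l (area s x + area s y) r" "inside r C"
    using placed by (auto simp: placed_def)
  obtain a b where ab: "by_size s tie x y = (a, b)" by fastforce
  obtain q p where qp: "split_rect r (area s a) (area s b) = (q, p)" by fastforce
  have yx: "area s y \<le> area s x"
    using inv by (simp add: huffman_inv_def nonincreasing_def sorted_wrt_append)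
  \<comment> \<open>\<open>y\<close> can take the role of the larger sub-module only in a tie, and
    then the ratio bound holds in either order.\<close>
  have cases: "a = x \<and> b = y \<or> a = y \<and> b = x \<and> area s x = area s y"
    using ab yx by (auto simp: by_size_def split: if_splits)
  have dist: "x \<noteq> y" "x \<notin> set rest" "y \<notin> set rest"
    using distinct_leavesD[OF inv_leaves(1)[OF inv]] by auto
  \<comment> \<open>Otherwise the leaves of \<open>x\<close> would occur twice. This makes the
    rectangle being cut separated from those of all entries of \<open>rest\<close>.\<close>
  have notin: "Merge x y \<notin> set rest"
  proof
    assume "Merge x y \<in> set rest"
    then have "hd (leaves x) \<in> set (concat (map leaves rest))" by (force intro!: bexI)
    moreover have "hd (leaves x) \<in> set (leaves x)" by simp
    moreover have "set (concat (map leaves rest)) \<inter> set (leaves x) = {}"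
      using inv_leaves(1)[OF inv] by (auto simp del: set_concat)
    ultimately show False by blast
  qed
  have pos: "area s x > 0" "area s y > 0" using inv_area(3)[OF inv] by auto
  have sep: "fits l (area s a) q \<and> fits l (area s b) p \<and> inside q r \<and> inside p r \<and> separated q p"
  proof (rule fits_split_rect[OF _ _ _ _ qp])
    show "fits l (area s a + area s b) r" using cases r(2) by (auto simp: add.commute)
    show "area s a \<le> (l - 1) * area s b" using cases merge_ratio[OF inv] by auto
  qed (use cases pos yx in auto)
  define R' where "R' = R(a \<mapsto> q, b \<mapsto> p)"
  have R': "imp_stage2 s tie R [Merge x y] = R'"
    by (simp add: ab qp r(1) R'_def)
  have neq: "a \<noteq> b" and set: "set (rest @ [x, y]) = insert a (insert b (set rest))"
    using cases dist by auto
  have ab_notin: "a \<notin> set rest" "b \<notin> set rest" using cases dist by auto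
  have vals: "R' a = Some q" "R' b = Some p" "\<And>m. m \<in> set rest \<Longrightarrow> R' m = R m"
    using neq ab_notin by (auto simp: R'_def)
  have old: "\<exists>t. R m = Some t \<and> fits l (area s m) t \<and> inside t C"
      "separated r (the (R m))" if "m \<in> set rest" for m
  proof -
    show "\<exists>t. R m = Some t \<and> fits l (area s m) t \<and> inside t C"
      using placed that by (auto simp: placed_def)
    have "m \<noteq> Merge x y" using that notin by auto
    then have "separated (the (R (Merge x y))) (the (R m))"
      using placed that by (auto simp: placed_def)
    then show "separated r (the (R m))" using r(1) by simp
  qed
  have old_sep: "separated (the (R m)) (the (R m'))" if "m \<in> set rest" "m' \<in> set rest" "m \<noteq> m'"
    for m m'
    using placed that by (auto simp: placed_def)
  \<comment> \<open>The two parts lie inside \<open>r\<close> and inherit its separation from the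
    other rectangles.\<close>
  have new: "separated q (the (R m))" "separated p (the (R m))"
      "separated (the (R m)) q" "separated (the (R m)) p" if "m \<in> set rest" for m
    using old(2)[OF that] sep separated_inside separated_sym by blast+
  have "inside q C" "inside p C" using sep r(3) inside_trans by blast+
  with sep old old_sep new separated_sym[of q p] show ?thesis
    unfolding placed_def R' set by (auto simp: vals)
qed

text \<open>\<open>pre\<close> collects the merges still to come, latest on top; Stage II on
  \<open>pre\<close> alone already places the current sequence. The stack \<open>st\<close> is
  arbitrary because each recursive call pushes onto it.\<close>

lemma imp_stages:
  assumes "huffman_inv ms" "fits l (\<Sum>k=1..n. s k) C"
  shows "\<exists>m pre. imp_stage1 s ms st = ([m], pre @ st) \<and>
    placed C (imp_stage2 s tie [m \<mapsto> C] pre) ms"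
  using assms(1)
proof (induction ms arbitrary: st rule: measure_induct_rule[of length])
  case (less ms)
  show ?case
  proof (cases "length ms > 1")
    case True
    define rest x y where "rest = butlast (butlast ms)" and "x = last (butlast ms)" and "y = last ms"
    have "butlast ms \<noteq> []" "ms \<noteq> []" using True by (auto simp: butlast_conv_take take_eq_Nil)
    then have ms: "ms = rest @ [x, y]"
      by (metis append.assoc append_Cons append_Nil append_butlast_last_id rest_def x_def y_def)
    let ?ms = "insert_cmod s (Merge x y) rest"
    have step: "imp_stage1 s ms st = imp_stage1 s ?ms (Merge x y # st)"
      using True by (subst imp_stage1.simps) (simp add: Let_def rest_def x_def y_def)
    obtain m pre where pre: "imp_stage1 s ?ms (Merge x y # st) = ([m], pre @ Merge x y # st)"
      "placed C (imp_stage2 s tie [m \<mapsto> C] pre) ?ms"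
      using less.IH[of ?ms "Merge x y # st"] inv_step less.prems unfolding ms
      by (auto simp del: fun_upd_apply)
    \<comment> \<open>The current merge lies below all later ones, so it is popped after
      them.\<close>
    have "placed C (imp_stage2 s tie [m \<mapsto> C] (pre @ [Merge x y])) ms"
      unfolding imp_stage2_append ms
      using placed_step less.prems pre(2) unfolding ms by blast
    then show ?thesis using step pre(1) by (intro exI[of _ m] exI[of _ "pre @ [Merge x y]"])
        (simp del: fun_upd_apply)
  next
    case False
    have "ms \<noteq> []" using inv_leaves(2)[OF less.prems] n by auto
    then obtain m where ms: "ms = [m]" using False by (cases ms) auto
    \<comment> \<open>The one remaining module contains all original modules, so its area is that of
      \<open>C\<close>.\<close>
    have "area s m = (\<Sum>k=1..n. s k)"
      using inv_area(1)[OF less.prems, of m] inv_leaves(2)[OF less.prems] ms by simp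
    then have "placed C (imp_stage2 s tie [m \<mapsto> C] []) ms"
      using assms(2) by (auto simp: placed_def ms inside_def)
    then show ?thesis
      by (intro exI[of _ m] exI[of _ "[]"]) (simp add: ms imp_stage1.simps del: fun_upd_apply)
  qed
qed

end

section \<open>From the placed initial sequence to the feasible layout\<close>

theorem theorem1:
  fixes n :: nat and s lam :: "nat \<Rightarrow> real" and W H lambda :: real
    and tie :: "cmod \<Rightarrow> cmod \<Rightarrow> bool"
  assumes "n \<ge> 1"
    and "\<forall>i\<in>{1..n}. \<forall>j\<in>{1..n}. i \<le> j \<longrightarrow> s i \<ge> s j" and "s n > 0"
    and "W > 0" and "H > 0" and "W * H = (\<Sum>k=1..n. s k)"
    and "lambda \<ge> 3" and "\<forall>i\<in>{1..n}. lam i = lambda"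
    and "1 / lambda \<le> H / W" and "H / W \<le> lambda"
    and "n \<ge> 2 \<longrightarrow> (MAX i\<in>{1..n - 1}. s i / (\<Sum>j=i + 1..n. s j)) \<le> lambda - 1"
  shows "\<exists>P :: nat \<Rightarrow> rect.
    (\<forall>i\<in>{1..n}. imp n s W H tie i = Some (P i)) \<and>
    feasible_layout n s lam W H
      (\<lambda>i. width (P i)) (\<lambda>i. height (P i))
      (\<lambda>i. x1 (P i)) (\<lambda>i. y1 (P i)) (\<lambda>i. x2 (P i)) (\<lambda>i. y2 (P i))"
proof -
  have tail: "s i \<le> (lambda - 1) * (\<Sum>j=i + 1..n. s j)" if i: "1 \<le> i" "i < n" for i
  proof -
    let ?f = "\<lambda>i. s i / (\<Sum>j=i + 1..n. s j)"
    \<comment> \<open>An index with 1 \<le> i < n exists only for n \<ge> 2, where hypothesis (3) is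
      available.\<close>
    have "?f i \<le> (MAX i\<in>{1..n - 1}. ?f i)" using i by (intro Max_ge) auto
    also have "\<dots> \<le> lambda - 1" using assms(11) i by auto
    finally have "?f i \<le> lambda - 1" .
    moreover have "s j > 0" if "j \<in> {1..n}" for j
      using assms(1,2,3) that by (metis atLeastAtMost_iff less_le_trans order_refl)
    then have "(\<Sum>j=i + 1..n. s j) > 0" using i by (intro sum_pos) auto
    ultimately show ?thesis by (simp add: pos_divide_le_eq)
  qed
  interpret soft_modules n s lambda
    by standard (use assms tail in auto)
  let ?C = "Rect 0 0 W H" and ?ms = "map Soft [1..<n + 1]"
  have "fits lambda (\<Sum>k=1..n. s k) ?C"
    using assms(4-6,9,10) by (simp add: fits_def width_def height_def aspect_ratio_def)
  then obtain m pre where pre: "imp_stage1 s ?ms [] = ([m], pre @ [])"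
    "placed ?C (imp_stage2 s tie [m \<mapsto> ?C] pre) ?ms"
    using imp_stages[OF inv_init] by blast
  define R where "R = imp_stage2 s tie [m \<mapsto> ?C] pre"
  \<comment> \<open>\<open>the\<close> is safe for indices in \<open>{1..n}\<close>:
    \<open>placed\<close> guarantees a rectangle for every entry of the initial sequence.\<close>
  define P where "P i = the (R (Soft i))" for i
  have imp: "imp n s W H tie i = R (Soft i)" for i
    using pre(1) by (simp add: imp_def R_def del: upt_Suc)
  have one: "R (Soft i) = Some (P i)" "fits lambda (s i) (P i)" "inside (P i) ?C"
    if "i \<in> {1..n}" for i
  proof -
    have "Soft i \<in> set ?ms" using that by auto
    then have "\<exists>r. R (Soft i) = Some r \<and> fits lambda (area s (Soft i)) r \<and> inside r ?C"
      using pre(2) unfolding placed_def R_def[symmetric] by blast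
    then show "R (Soft i) = Some (P i)" "fits lambda (s i) (P i)" "inside (P i) ?C"
      by (auto simp: P_def)
  qed
  have two: "separated (P i) (P j)" if "i \<in> {1..n}" "j \<in> {1..n}" "i \<noteq> j" for i j
  proof -
    have "Soft i \<in> set ?ms" "Soft j \<in> set ?ms" "Soft i \<noteq> Soft j" using that by auto
    then show ?thesis using pre(2) unfolding placed_def R_def[symmetric] P_def by blast
  qed
  have "feasible_layout n s lam W H
      (\<lambda>i. width (P i)) (\<lambda>i. height (P i))
      (\<lambda>i. x1 (P i)) (\<lambda>i. y1 (P i)) (\<lambda>i. x2 (P i)) (\<lambda>i. y2 (P i))"
    unfolding feasible_layout_def
  proof (intro conjI ballI impI)
    fix i j assume "i \<in> {1..n}" "j \<in> {1..n}" "i \<noteq> j"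
    then show "Max {x1 (P i) - x2 (P j), y1 (P i) - y2 (P j), x1 (P j) - x2 (P i),
        y1 (P j) - y2 (P i)} \<ge> 0"
      using two[of i j] by (auto simp: separated_def le_max_iff_disj)
  next
    fix i assume i: "i \<in> {1..n}"
    show "width (P i) > 0" "height (P i) > 0" "width (P i) * height (P i) = s i"
      "x2 (P i) - x1 (P i) = width (P i)" "y2 (P i) - y1 (P i) = height (P i)"
      "1 / lam i \<le> height (P i) / width (P i)" "height (P i) / width (P i) \<le> lam i"
      "0 \<le> x1 (P i)" "x1 (P i) \<le> W" "0 \<le> x2 (P i)" "x2 (P i) \<le> W"
      "0 \<le> y1 (P i)" "y1 (P i) \<le> H" "0 \<le> y2 (P i)" "y2 (P i) \<le> H"
      using one(2,3)[OF i] i assms(8)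
      by (auto simp: fits_def inside_def aspect_ratio_def width_def height_def)
  qed
  then show ?thesis unfolding imp using one(1) by blast
qed

end
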